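(* Let $n\ge 3$ be an integer. The cyclotomic polynomial $\Phi_n(X)$ is indecomposable if and only if $n$ is a product of distinct prime numbers or $n=4$.
   Context: $\Phi_n(X)$ is the minimal monic polynomial over $\mathbb{Q}$ of a primitive $n$-th root of unity, regarded as a polynomial in $K[X]$, where $K$ is a field of characteristic $0$ that is radically closed (every $X^m-a$, $a\in K$, $m\ge 2$, splits over $K$). A polynomial $P$ of degree $\ge 2$ is decomposable if $P=Q\circ R$ for polynomials $Q,R$ (with coefficients in $K$ or in an extension of $K$) of degrees $\ge 2$; otherwise it is indecomposable. *)

theory Defs
  imports
    "Jordan_Normal_Form.Char_Poly"
    "HOL-Computational_Algebra.Computational_Algebra"
begin

definition primitive_root_of_unity :: "nat \<Rightarrow> 'a::field \<Rightarrow> bool" where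
  "primitive_root_of_unity n z \<longleftrightarrow>
     n > 0 \<and> z ^ n = 1 \<and> (\<forall>k. 0 < k \<and> k < n \<longrightarrow> z ^ k \<noteq> 1)"

text \<open>The description is only meaningful for \<open>z\<close> algebraic over the rationals.\<close>

definition rat_min_poly :: "'a::field_char_0 \<Rightarrow> rat poly" where
  "rat_min_poly z =
     (THE p. lead_coeff p = 1 \<and> poly (map_poly of_rat p) z = 0 \<and>
        (\<forall>q. q \<noteq> 0 \<and> poly (map_poly of_rat q) z = 0 \<longrightarrow> degree p \<le> degree q))"

text \<open>The primitive root of unity is taken in the complex numbers; all primitive \<open>n\<close>-th roots
  of unity have the same minimal polynomial.\<close>

definition cyclotomic_poly :: "nat \<Rightarrow> rat poly" where
  "cyclotomic_poly n = rat_min_poly (SOME z :: complex. primitive_root_of_unity n z)"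

definition splits :: "'a::field poly \<Rightarrow> bool" where
  "splits p \<longleftrightarrow> (\<exists>c A. p = Polynomial.smult c (\<Prod>a\<in>#A. [:- a, 1:]))"

text \<open>The argument is a dummy that carries the field as its type.\<close>

definition radically_closed :: "'a::field itself \<Rightarrow> bool" where
  "radically_closed _ \<longleftrightarrow> (\<forall>m (a::'a). m \<ge> 2 \<longrightarrow> splits (monom 1 m - [:a:]))"

text \<open>An extension of the coefficient field is given by a field homomorphism \<open>h\<close> out of it, which
  is automatically injective; \<open>h = id\<close> is decomposability over the coefficient field itself.
  A definition in HOL cannot quantify over all extension fields, as these are types; this
  quantification takes place at the level of theorems, where \<open>h\<close> and its target type are
  arbitrary.\<close>

definition decomposable_over :: "('a::field \<Rightarrow> 'b::field) \<Rightarrow> 'a poly \<Rightarrow> bool" where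
  "decomposable_over h P \<longleftrightarrow> degree P \<ge> 2 \<and>
     (\<exists>Q R. degree Q \<ge> 2 \<and> degree R \<ge> 2 \<and> map_poly h P = pcompose Q R)"

definition indecomposable_over :: "('a::field \<Rightarrow> 'b::field) \<Rightarrow> 'a poly \<Rightarrow> bool" where
  "indecomposable_over h P \<longleftrightarrow> degree P \<ge> 2 \<and> \<not> decomposable_over h P"

end

theory Submission
  imports Defs "HOL-Number_Theory.Totient"
begin

text \<open>
  Let \<open>\<Phi>\<close> denote the \<open>n\<close>-th cyclotomic polynomial. Over a radically closed field \<open>K\<close> of
  characteristic 0 it is the product of the distinct linear factors \<open>X - z\<close>, where \<open>z\<close> runs
  through the primitive \<open>n\<close>-th roots of unity of \<open>K\<close>
  (\<open>cyclotomic_poly_over_radically_closed\<close>). This contains the irreducibility of \<open>\<Phi>\<close> over the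
  rationals, whose arithmetic core is \<open>min_int_poly_prime_power_root\<close>. Everything else is read
  off from this factorization.

  If \<open>n\<close> is not squarefree, then \<open>n = p * m\<close> with a prime \<open>p\<close> dividing \<open>m\<close>, and \<open>\<Phi>\<close> is
  the \<open>m\<close>-th cyclotomic polynomial evaluated at \<open>X ^ p\<close>, because the two polynomials have the
  same roots. This is a decomposition as soon as \<open>totient m \<ge> 2\<close>, that is, unless \<open>n = 4\<close>, where
  the degree of \<open>\<Phi>\<close> is 2.

  Conversely, suppose \<open>\<Phi> = Q \<circ> R\<close> over some extension field. Each root \<open>\<beta>\<close> of \<open>Q\<close> gives a block
  of primitive roots, namely the roots of \<open>R - \<beta>\<close>. Since \<open>degree R \<ge> 2\<close>, the polynomials
  \<open>R - \<beta>\<close> all have the same two top coefficients, so all blocks have the same sum; since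
  \<open>degree Q \<ge> 2\<close>, there are at least two blocks (\<open>decomposable_equal_block_sums\<close>). Two blocks with
  equal sums give a nontrivial linear relation with integer coefficients between primitive roots.
  For squarefree \<open>n\<close> no such relation exists (\<open>primitive_roots_linear_independent\<close>). This argument
  does not touch the coefficients of \<open>Q\<close> and \<open>R\<close>, and so it works over every extension field.
\<close>

section \<open>Minimal polynomials over the integers\<close>

text \<open>For an algebraic integer \<open>x\<close> this is its minimal polynomial. Working with integer
  coefficients and divisibility makes the notion independent of the field in which \<open>x\<close> lives.\<close>

definition min_int_poly :: "int poly \<Rightarrow> 'a::field_char_0 \<Rightarrow> bool" where
  "min_int_poly g x \<longleftrightarrow> lead_coeff g = 1 \<and> (\<forall>q. poly (of_int_poly q) x = 0 \<longleftrightarrow> g dvd q)"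

lemma min_int_poly_root_iff:
  "min_int_poly g x \<Longrightarrow> poly (of_int_poly q) x = 0 \<longleftrightarrow> g dvd q"
  by (simp add: min_int_poly_def)

lemma monic_unity_poly:
  assumes "n > 0"
  shows "degree (monom 1 n - 1 :: 'a::comm_ring_1 poly) = n"
    and "lead_coeff (monom 1 n - 1 :: 'a::comm_ring_1 poly) = 1"
proof -
  have "degree (monom 1 n + (- 1) :: 'a poly) = degree (monom 1 n :: 'a poly)"
    using assms by (intro degree_add_eq_left) (simp add: degree_monom_eq)
  then show deg: "degree (monom 1 n - 1 :: 'a poly) = n" by (simp add: degree_monom_eq)
  show "lead_coeff (monom 1 n - 1 :: 'a poly) = 1"
    unfolding deg using assms by simp
qed

text \<open>A nonzero integer polynomial of least degree that vanishes at \<open>x\<close> is made primitive;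
  pseudo-division and the multiplicativity of the content then show that it divides every integer
  polynomial vanishing at \<open>x\<close>. As it divides a monic polynomial, its leading coefficient is a
  unit.\<close>

lemma min_int_poly_exists:
  fixes x :: "'a::field_char_0"
  assumes "lead_coeff f = 1" "poly (of_int_poly f) x = 0"
  shows "\<exists>g. min_int_poly g x"
proof -
  define Z where "Z q \<longleftrightarrow> q \<noteq> 0 \<and> poly (of_int_poly q) x = 0" for q
  have "f \<noteq> 0" using assms(1) by auto
  then have "Z f" using assms(2) by (simp add: Z_def)
  define q0 where "q0 = arg_min degree Z"
  have q0: "Z q0" and q0_min: "\<And>q. Z q \<Longrightarrow> degree q0 \<le> degree q"
    using arg_min_nat_lemma[of Z, OF \<open>Z f\<close>, of degree] unfolding q0_def by auto
  define g where "g = primitive_part q0"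
  have "q0 = Polynomial.smult (content q0) g" by (simp add: g_def)
  then have "poly (of_int_poly q0) x = of_int (content q0) * poly (of_int_poly g) x"
    by (metis of_int_hom.map_poly_hom_smult poly_smult)
  then have gx: "poly (of_int_poly g) x = 0" and g0: "g \<noteq> 0"
    using q0 by (auto simp: Z_def g_def)
  have content_g: "content g = 1" using q0 by (simp add: g_def Z_def)
  have g_dvd: "g dvd q" if "poly (of_int_poly q) x = 0" for q
  proof -
    define r where "r = pseudo_mod q g"
    obtain a t where a: "a \<noteq> 0" "Polynomial.smult a q = g * t + r"
      using pseudo_mod(1)[OF g0] unfolding r_def by blast
    have "poly (of_int_poly (Polynomial.smult a q)) x = poly (of_int_poly (g * t + r)) x" by (simp add: a)
    then have "poly (of_int_poly r) x = 0" using that gx by (simp add: hom_distribs)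
    moreover have "r = 0 \<or> degree r < degree q0"
      using pseudo_mod(2)[OF g0] unfolding r_def g_def by auto
    ultimately have "r = 0" using q0_min unfolding Z_def by (meson leD)
    then have aq: "Polynomial.smult a q = g * t" using a by simp
    \<comment> \<open>Gauss's lemma: \<open>g\<close> is primitive, so the factor \<open>a\<close> introduced by the pseudo-division can
    be cancelled from the quotient \<open>t\<close>.\<close>
    then have "content t = normalize a * content q"
      using content_g by (metis content_mult content_smult mult_1)
    then have "a dvd content t" by simp
    then obtain c where "content t = a * c" by (elim dvdE)
    then have "t = Polynomial.smult a (Polynomial.smult c (primitive_part t))"
      by (metis content_times_primitive_part smult_smult)
    then obtain t' where "t = Polynomial.smult a t'" ..
    then have "Polynomial.smult a q = Polynomial.smult a (g * t')" using aq by simp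
    then have "Polynomial.smult a (q - g * t') = 0" by (simp add: smult_diff_right)
    then show ?thesis using a(1) by simp
  qed
  have "lead_coeff g dvd lead_coeff f"
    using g_dvd[OF assms(2)] by (metis dvdE dvdI lead_coeff_mult)
  then have "lead_coeff g = 1 \<or> lead_coeff g = - 1"
    using assms(1) by (simp add: zdvd1_eq abs_if split: if_splits)
  moreover have dvd_root: "poly (of_int_poly q) x = 0" if "g dvd q" for q
    using that gx by (auto elim!: dvdE simp: hom_distribs)
  then have "g dvd q \<longleftrightarrow> poly (of_int_poly q) x = 0" for q using g_dvd by blast
  ultimately have "min_int_poly g x \<or> min_int_poly (- g) x"
    by (auto simp: min_int_poly_def)
  then show ?thesis by blast
qed

text \<open>Minimal polynomials are irreducible, so each of them is the minimal polynomial of all its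
  roots. The roots may lie in different fields; this carries information from the complex numbers,
  where cyclotomic polynomials are defined, to an arbitrary field of characteristic 0.\<close>

lemma min_int_poly_transfer:
  fixes x :: "'a::field_char_0" and y :: "'b::field_char_0"
  assumes g: "min_int_poly g x" and y: "poly (of_int_poly g) y = 0"
  shows "min_int_poly g y"
proof -
  obtain g' where g': "min_int_poly g' y"
    using min_int_poly_exists[OF _ y] g by (auto simp: min_int_poly_def)
  then have "g' dvd g" using y by (simp add: min_int_poly_def)
  then obtain u where u: "g = g' * u" by (elim dvdE)
  have "poly (of_int_poly g) x = 0" using g by (simp add: min_int_poly_def)
  then have "poly (of_int_poly g') x = 0 \<or> poly (of_int_poly u) x = 0"
    by (simp add: u hom_distribs)
  then have "g dvd g'"
  proof
    assume "poly (of_int_poly u) x = 0"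
    then have "g dvd u" using g by (simp add: min_int_poly_def)
    then have "g' * u dvd 1 * u" using u by simp
    moreover have "u \<noteq> 0" using g u by (auto simp: min_int_poly_def)
    ultimately have "g' dvd 1" using dvd_mult_cancel_right by blast
    then have "poly (of_int_poly 1) y = 0" using g' unfolding min_int_poly_def by blast
    then show ?thesis by simp
  qed (use g in \<open>simp add: min_int_poly_def\<close>)
  then have "g dvd q \<longleftrightarrow> g' dvd q" for q using \<open>g' dvd g\<close> dvd_trans by blast
  then show ?thesis using g g' by (simp add: min_int_poly_def)
qed

section \<open>Conjugates of a root of unity\<close>

text \<open>The Frobenius congruences modulo a prime \<open>p\<close>. They are stated as divisibilities, because
  they are used in the integers and in polynomials over the integers, which do not have
  characteristic \<open>p\<close>.\<close>

lemma prime_dvd_power_add: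
  fixes x y :: "'a::comm_ring_1"
  assumes p: "prime p"
  shows "of_nat p dvd (x + y) ^ p - (x ^ p + y ^ p)"
proof -
  have p0: "p > 0" using p prime_gt_0_nat by blast
  have "(x + y) ^ p = (\<Sum>k\<le>p. of_nat (p choose k) * x ^ k * y ^ (p - k))"
    by (rule binomial_ring)
  also have "\<dots> = (\<Sum>k\<in>{0,p}. of_nat (p choose k) * x ^ k * y ^ (p - k))
      + (\<Sum>k\<in>{..p} - {0,p}. of_nat (p choose k) * x ^ k * y ^ (p - k))"
    by (subst add.commute, rule sum.subset_diff) auto
  also have "(\<Sum>k\<in>{0,p}. of_nat (p choose k) * x ^ k * y ^ (p - k)) = x ^ p + y ^ p"
    using p0 by simp
  finally have "(x + y) ^ p - (x ^ p + y ^ p)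
      = (\<Sum>k\<in>{..p} - {0,p}. of_nat (p choose k) * x ^ k * y ^ (p - k))" by simp
  also have "of_nat p dvd \<dots>"
  proof (rule dvd_sum)
    fix k assume "k \<in> {..p} - {0,p}"
    then have "p dvd (p choose k)" using p by (intro dvd_choose_prime) auto
    then show "of_nat p dvd of_nat (p choose k) * x ^ k * y ^ (p - k)"
      by (auto elim!: dvdE)
  qed
  finally show ?thesis .
qed

lemma prime_dvd_power_diff_self:
  fixes a :: int
  assumes p: "prime p"
  shows "int p dvd a ^ p - a"
proof (induction a rule: int_induct[where k = 0])
  case base
  then show ?case using p prime_gt_0_nat[of p] by (simp add: power_0_left)
next
  case (step1 i)
  have "int p dvd ((i + 1) ^ p - (i ^ p + 1 ^ p)) + (i ^ p - i)"
    using prime_dvd_power_add[OF p, of i 1] step1 by (intro dvd_add) auto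
  then show ?case by (simp add: algebra_simps)
next
  case (step2 i)
  have "int p dvd i ^ p - ((i - 1) ^ p + 1)"
    using prime_dvd_power_add[OF p, of "i - 1" 1] by simp
  from dvd_diff[OF step2(2) this] show ?case by (simp add: algebra_simps)
qed

lemma pcompose_monom_cong_power:
  fixes g :: "int poly"
  assumes p: "prime p"
  shows "of_nat p dvd pcompose g (monom 1 p) - g ^ p"
proof (induction g)
  case 0
  then show ?case using p prime_gt_0_nat[of p] by (simp add: power_0_left)
next
  case (pCons a g)
  let ?X = "monom 1 1 :: int poly"
  have eq: "pCons a g = [:a:] + ?X * g" by (simp add: monom_Suc)
  have 1: "of_nat p dvd pCons a g ^ p - ([:a:] ^ p + (?X * g) ^ p)"
    unfolding eq by (rule prime_dvd_power_add[OF p])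
  have "[:int p:] dvd [:a ^ p - a:]"
    using prime_dvd_power_diff_self[OF p, of a] by (simp add: const_poly_dvd)
  then have 2: "of_nat p dvd [:a:] ^ p - [:a:]"
    by (simp add: of_nat_poly poly_const_pow)
  have 3: "of_nat p dvd monom 1 p * (pcompose g (monom 1 p) - g ^ p)"
    using pCons.IH by (rule dvd_mult)
  have "pcompose (pCons a g) (monom 1 p) - pCons a g ^ p =
     monom 1 p * (pcompose g (monom 1 p) - g ^ p)
       - (pCons a g ^ p - ([:a:] ^ p + (?X * g) ^ p)) - ([:a:] ^ p - [:a:])"
    by (simp add: pcompose_pCons algebra_simps monom_power power_mult_distrib)
  then show ?case using 1 2 3 by (metis dvd_diff)
qed

text \<open>If \<open>g\<close> is the minimal polynomial of \<open>x\<close>, then the powers \<open>1, x, \<dots>, x ^ (degree g - 1)\<close>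
  form a basis of the ring generated by \<open>x\<close>; hence an integer that is a multiple of \<open>p\<close> in that
  ring is a multiple of \<open>p\<close> in the integers. Without mentioning \<open>x\<close>: divide \<open>k\<close> by \<open>g\<close> and
  compare degrees.\<close>

lemma monic_dvd_const_mod:
  fixes g k :: "int poly"
  assumes g: "lead_coeff g = 1" "degree g > 0" and dvd: "g dvd [:n:] - Polynomial.smult p k"
  shows "p dvd n"
proof -
  obtain a r where k: "pseudo_divmod k g = (a, r)" by fastforce
  have g0: "g \<noteq> 0" using g by auto
  have k_eq: "k = g * a + r" and r: "r = 0 \<or> degree r < degree g"
    using pseudo_divmod[OF g0 k] g(1) by simp_all
  obtain m where m: "[:n:] - Polynomial.smult p k = g * m" using dvd by (elim dvdE)
  then have eq: "[:n:] - Polynomial.smult p r = g * (m + Polynomial.smult p a)"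
    by (simp add: k_eq algebra_simps smult_add_right)
  have "degree ([:n:] - Polynomial.smult p r) < degree g"
    by (rule degree_diff_less) (use r g(2) in \<open>auto intro: le_less_trans[OF degree_smult_le]\<close>)
  then have "m + Polynomial.smult p a = 0"
    unfolding eq using degree_mult_eq[of g "m + Polynomial.smult p a"] g0 by (cases "m + Polynomial.smult p a = 0") auto
  then have "[:n:] = Polynomial.smult p r" using eq by simp
  then have "coeff [:n:] 0 = p * coeff r 0" by simp
  then show ?thesis by simp
qed

text \<open>Write \<open>X ^ n - 1 = g * h\<close> and \<open>v = w ^ p\<close>. By Frobenius, \<open>g v\<close> is \<open>p\<close> times an element
  of the ring generated by \<open>w\<close>. If \<open>g v\<close> were nonzero, then \<open>h v = 0\<close>, and differentiating the
  factorization at \<open>v\<close> would give \<open>n * v ^ (n - 1) = g v * h' v\<close>. So \<open>n\<close> would be divisible by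
  \<open>p\<close> in that ring, hence in the integers.\<close>

lemma min_int_poly_prime_power_root:
  fixes w :: "'a::field_char_0"
  assumes g: "min_int_poly g w" and w: "w ^ n = 1" "n > 0" and p: "prime p" "\<not> p dvd n"
  shows "poly (of_int_poly g) (w ^ p) = 0"
proof (rule ccontr)
  assume gv: "poly (of_int_poly g) (w ^ p) \<noteq> 0"
  define v where "v = w ^ p"
  have vn: "v ^ n = 1" using w by (simp add: v_def power_mult [symmetric] mult.commute[of p] power_mult)
  define f :: "int poly" where "f = monom 1 n - 1"
  have f_eval: "poly (of_int_poly f) x = x ^ n - 1" for x :: 'a
    by (simp add: f_def hom_distribs poly_monom)
  have gw: "poly (of_int_poly g) w = 0" using g by (simp add: min_int_poly_def)
  have "g dvd f" using min_int_poly_root_iff[OF g, of f] w f_eval by simp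
  then obtain h where f: "f = g * h" by (elim dvdE)
  have hv: "poly (of_int_poly h) v = 0"
    using f_eval[of v] gv vn by (simp add: f v_def hom_distribs)
  obtain u where u: "pcompose g (monom 1 p) - g ^ p = of_nat p * u"
    using pcompose_monom_cong_power[OF p(1), of g] by (elim dvdE)
  have "poly (of_int_poly (pcompose g (monom 1 p))) w = poly (of_int_poly (g ^ p + of_nat p * u)) w"
    by (simp add: u [symmetric])
  then have gv_eq: "poly (of_int_poly g) v = of_nat p * poly (of_int_poly u) w"
    using gw p prime_gt_0_nat[of p]
    by (simp add: hom_distribs poly_pcompose poly_monom v_def power_0_left)
  have "pderiv f = g * pderiv h + h * pderiv g"
    by (simp add: f pderiv_mult)
  moreover have "pderiv f = monom (int n) (n - 1)"
    by (simp add: f_def pderiv_diff pderiv_monom)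
  ultimately have "poly (of_int_poly (monom (int n) (n - 1))) v
      = poly (of_int_poly (g * pderiv h + h * pderiv g)) v" by simp
  then have "of_nat n * v ^ (n - 1)
      = poly (of_int_poly g) v * poly (of_int_poly (pderiv h)) v"
    using hv by (simp add: hom_distribs poly_monom)
  then have "of_nat n * v ^ (n - 1) * v
      = poly (of_int_poly g) v * poly (of_int_poly (pderiv h)) v * v" by simp
  moreover have "v ^ (n - 1) * v = 1" using vn w(2) by (metis power_minus_mult)
  ultimately have n_eq: "of_nat n = of_nat p * poly (of_int_poly u) w * poly (of_int_poly (pderiv h)) v * v"
    by (metis gv_eq mult.assoc mult.right_neutral)
  define k where "k = u * pcompose (pderiv h) (monom 1 p) * monom 1 p"
  have "poly (of_int_poly ([:int n:] - Polynomial.smult (int p) k)) w = 0"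
    using n_eq by (simp add: k_def hom_distribs poly_pcompose poly_monom v_def mult.assoc)
  then have "g dvd [:int n:] - Polynomial.smult (int p) k"
    using g by (simp add: min_int_poly_def)
  then have "int p dvd int n"
  proof (rule monic_dvd_const_mod[rotated 2])
    show "lead_coeff g = 1" using g by (simp add: min_int_poly_def)
    show "degree g > 0"
    proof (rule ccontr)
      assume "\<not> degree g > 0"
      then have "g = 1" using g by (auto simp: min_int_poly_def elim!: degree_eq_zeroE)
      then show False using gw by simp
    qed
  qed
  then show False using p by simp
qed

lemma min_int_poly_coprime_power:
  fixes w :: "'a::field_char_0"
  assumes g: "min_int_poly g w" and w: "w ^ n = 1" "n > 0" and "coprime k n"
  shows "min_int_poly g (w ^ k)"
  using \<open>coprime k n\<close>
proof (induction k rule: less_induct)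
  case (less k)
  consider "k = 0" | "k = 1" | "k > 1" by linarith
  then show ?case
  proof cases
    case 1
    then show ?thesis using less.prems g w by simp
  next
    case 2
    then show ?thesis using g by simp
  next
    case 3
    then obtain p where p: "prime p" "p dvd k" using prime_factor_nat[of k] by auto
    then obtain k' where k: "k = p * k'" by (elim dvdE)
    have "k' > 0" using 3 k by (cases k') auto
    then have "k' < k" using p(1) prime_gt_1_nat[of p] by (simp add: k)
    moreover have "coprime k' n" "coprime p n" using less.prems by (simp_all add: k)
    ultimately have "min_int_poly g (w ^ k')" using less.IH by blast
    moreover have "\<not> p dvd n" using \<open>coprime p n\<close> p(1) by (metis coprime_absorb_left not_prime_unit)
    moreover have "(w ^ k') ^ n = 1" using w(1) by (metis mult.commute power_mult power_one)
    ultimately have "poly (of_int_poly g) ((w ^ k') ^ p) = 0"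
      using min_int_poly_prime_power_root w(2) p(1) by blast
    then show ?thesis using min_int_poly_transfer[OF g] by (simp add: k power_mult mult.commute flip: power_mult)
  qed
qed

lemma min_int_poly_root_primitive:
  fixes x :: "'a::field_char_0" and y :: "'b::field_char_0"
  assumes g: "min_int_poly g x" and y: "poly (of_int_poly g) y = 0"
  shows "primitive_root_of_unity n y \<longleftrightarrow> primitive_root_of_unity n x"
proof -
  have *: "z ^ k = 1 \<longleftrightarrow> g dvd monom 1 k - 1" if "min_int_poly g z" for z :: "'c::field_char_0" and k
    using min_int_poly_root_iff[OF that, of "monom 1 k - 1"] by (simp add: hom_distribs poly_monom)
  have "x ^ k = 1 \<longleftrightarrow> y ^ k = 1" for k
    using *[OF g] *[OF min_int_poly_transfer[OF g y]] by simp
  then show ?thesis by (simp add: primitive_root_of_unity_def)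
qed

section \<open>Primitive roots of unity as powers\<close>

lemma primitive_root_power_eq_1_iff:
  assumes w: "primitive_root_of_unity n w"
  shows "w ^ k = 1 \<longleftrightarrow> n dvd k"
proof
  assume "w ^ k = 1"
  have "w ^ k = (w ^ n) ^ (k div n) * w ^ (k mod n)"
    by (metis mult_div_mod_eq power_add power_mult)
  then have "w ^ (k mod n) = 1" using w \<open>w ^ k = 1\<close> by (simp add: primitive_root_of_unity_def)
  moreover have "k mod n < n" "\<forall>k. 0 < k \<and> k < n \<longrightarrow> w ^ k \<noteq> 1"
    using w by (simp_all add: primitive_root_of_unity_def)
  ultimately have "k mod n = 0" by (metis gr0I)
  then show "n dvd k" by auto
next
  assume "n dvd k"
  then show "w ^ k = 1" using w by (auto simp: primitive_root_of_unity_def power_mult)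
qed

lemma primitive_root_power_inj:
  assumes w: "primitive_root_of_unity n w"
  shows "inj_on (\<lambda>a. w ^ a) {..<n}"
proof (rule linorder_inj_onI')
  fix a b assume ab: "a \<in> {..<n}" "b \<in> {..<n}" "a < b"
  have "w \<noteq> 0" using w by (auto simp: primitive_root_of_unity_def power_0_left)
  have "w ^ b = w ^ a * w ^ (b - a)" using ab by (simp flip: power_add)
  moreover have "w ^ (b - a) \<noteq> 1"
    using ab primitive_root_power_eq_1_iff[OF w, of "b - a"] by (auto dest: dvd_imp_le)
  ultimately show "w ^ a \<noteq> w ^ b" using \<open>w \<noteq> 0\<close> by simp
qed

lemma primitive_root_powers:
  fixes w :: "'a::field"
  assumes w: "primitive_root_of_unity n w"
  shows "(\<lambda>a. w ^ a) ` {..<n} = {z :: 'a. z ^ n = 1}"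
proof (rule card_seteq)
  have n: "n > 0" using w by (simp add: primitive_root_of_unity_def)
  define f where "f = (monom 1 n - 1 :: 'a poly)"
  have f: "{z :: 'a. z ^ n = 1} = {z. poly f z = 0}" by (auto simp: f_def poly_monom)
  have deg: "degree f = n" unfolding f_def using n by (rule monic_unity_poly)
  then have "f \<noteq> 0" using n by auto
  then show "finite {z :: 'a. z ^ n = 1}" unfolding f by (rule poly_roots_finite)
  have "card {z :: 'a. z ^ n = 1} \<le> n"
    unfolding f using card_poly_roots_bound[OF \<open>f \<noteq> 0\<close>] deg by simp
  then show "card {z :: 'a. z ^ n = 1} \<le> card ((\<lambda>a. w ^ a) ` {..<n})"
    using card_image[OF primitive_root_power_inj[OF w]] by simp
  have "(w ^ a) ^ n = (w ^ n) ^ a" for a by (simp add: mult.commute flip: power_mult)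
  then show "(\<lambda>a. w ^ a) ` {..<n} \<subseteq> {z :: 'a. z ^ n = 1}"
    using w by (auto simp: primitive_root_of_unity_def)
qed

lemma primitive_root_power_iff:
  assumes w: "primitive_root_of_unity n w"
  shows "primitive_root_of_unity n (w ^ a) \<longleftrightarrow> coprime a n"
proof
  have n: "n > 0" using w by (simp add: primitive_root_of_unity_def)
  have eq1: "(w ^ a) ^ k = 1 \<longleftrightarrow> n dvd a * k" for k
    using primitive_root_power_eq_1_iff[OF w] by (simp flip: power_mult)
  {
    assume "coprime a n"
    then have dvd: "n dvd a * k \<longleftrightarrow> n dvd k" for k
      by (simp add: coprime_commute coprime_dvd_mult_right_iff)
    show "primitive_root_of_unity n (w ^ a)"
      unfolding primitive_root_of_unity_def eq1 dvd using n by (simp add: nat_dvd_not_less)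
  next
    assume prim: "primitive_root_of_unity n (w ^ a)"
    define d where "d = gcd a n"
    have d: "d dvd n" "d dvd a" "d > 0" using n by (simp_all add: d_def)
    have "n dvd a * (n div d)"
      using d by (metis div_mult_swap dvd_triv_right dvd_div_mult)
    then have "(w ^ a) ^ (n div d) = 1" using eq1 by blast
    then have "n dvd n div d" using primitive_root_power_eq_1_iff[OF prim] by blast
    then have "n \<le> n div d" using n d by (intro dvd_imp_le) (auto simp: dvd_imp_le div_greater_zero_iff)
    then have "d = 1" using n d div_less_dividend[of d n] by linarith
    then have "gcd a n = 1" by (simp only: d_def)
    then show "coprime a n" by (rule iffD2[OF coprime_iff_gcd_eq_1])
  }
qed

lemma primitive_roots_eq_image_totatives:
  fixes w :: "'a::field"
  assumes w: "primitive_root_of_unity n w" and "n > 1"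
  shows "{z. primitive_root_of_unity n z} = (\<lambda>a. w ^ a) ` totatives n"
    and "inj_on (\<lambda>a. w ^ a) (totatives n)"
proof -
  have sub: "totatives n \<subseteq> {..<n}" using totatives_less \<open>n > 1\<close> by auto
  then show "inj_on (\<lambda>a. w ^ a) (totatives n)"
    using primitive_root_power_inj[OF w] by (rule inj_on_subset[rotated])
  show "{z. primitive_root_of_unity n z} = (\<lambda>a. w ^ a) ` totatives n"
  proof (intro equalityI subsetI)
    fix z assume z: "z \<in> {z :: 'a. primitive_root_of_unity n z}"
    then have "z \<in> {z :: 'a. z ^ n = 1}" by (simp add: primitive_root_of_unity_def)
    then obtain a where a: "z = w ^ a" "a < n" using primitive_root_powers[OF w] by blast
    then have "coprime a n" using z primitive_root_power_iff[OF w] by simp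
    moreover from this have "a \<noteq> 0" using \<open>n > 1\<close> by (cases a) auto
    ultimately show "z \<in> (\<lambda>a. w ^ a) ` totatives n" using a by (auto simp: in_totatives_iff)
  qed (auto simp: in_totatives_iff primitive_root_power_iff[OF w])
qed

lemma finite_card_primitive_roots:
  assumes w: "primitive_root_of_unity n (w :: 'a::field)" and "n > 1"
  shows "finite {z::'a. primitive_root_of_unity n z}"
    and "card {z::'a. primitive_root_of_unity n z} = totient n"
  using primitive_roots_eq_image_totatives[OF assms] by (simp_all add: card_image totient_def)

lemma min_int_poly_all_primitive_roots:
  fixes w z :: "'a::field_char_0"
  assumes "min_int_poly g w" "primitive_root_of_unity n w" "primitive_root_of_unity n z"
  shows "min_int_poly g z"
proof -
  have "z \<in> {z :: 'a. z ^ n = 1}" using assms(3) by (simp add: primitive_root_of_unity_def)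
  then obtain a where "z = w ^ a" using primitive_root_powers[OF assms(2)] by blast
  moreover from this have "coprime a n" using primitive_root_power_iff assms by blast
  ultimately show ?thesis
    using min_int_poly_coprime_power[OF assms(1)] assms(2) by (auto simp: primitive_root_of_unity_def)
qed

section \<open>The cyclotomic polynomial\<close>

lemma complex_primitive_root_exists:
  assumes "n > 0"
  shows "\<exists>z::complex. primitive_root_of_unity n z"
proof
  have inj: "inj_on (\<lambda>k. cis (2 * pi * real k / real n)) {..<n}"
    using bij_betw_roots_unity[OF assms] by (rule bij_betw_imp_inj_on)
  have pow: "cis (2 * pi / real n) ^ k = cis (2 * pi * real k / real n)" for k
    by (simp add: DeMoivre mult.commute)
  have "cis (2 * pi / real n) ^ k \<noteq> 1" if "0 < k" "k < n" for k
    using inj_onD[OF inj, of k 0] that unfolding pow by auto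
  moreover have "cis (2 * pi / real n) ^ n = 1" unfolding pow using assms by simp
  ultimately show "primitive_root_of_unity n (cis (2 * pi / real n))"
    using assms by (simp add: primitive_root_of_unity_def)
qed

lemma rat_poly_clear_denominators:
  fixes q :: "rat poly"
  shows "\<exists>d q'. d > 0 \<and> Polynomial.smult (of_int d) q = of_int_poly q'"
proof (induction q)
  case 0
  show ?case by (intro exI[of _ 1] exI[of _ 0]) simp
next
  case (pCons a q)
  then obtain d q' where d: "d > 0" "Polynomial.smult (of_int d) q = of_int_poly q'" by blast
  obtain x y where a: "y > 0" "a = of_int x / of_int y"
    using quotient_of_denom_pos' quotient_of_div by (metis prod.collapse)
  have "Polynomial.smult (of_int (d * y)) (pCons a q)
      = pCons (of_int (d * x)) (Polynomial.smult (of_int y) (Polynomial.smult (of_int d) q))"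
    using a by (simp add: mult.commute)
  also have "\<dots> = of_int_poly (pCons (d * x) (Polynomial.smult y q'))"
    unfolding d(2) by (simp add: hom_distribs)
  finally show ?case using d(1) a(1) by (metis mult_pos_pos)
qed

lemma of_rat_poly_of_int_poly:
  "map_poly of_rat (of_int_poly q) = (of_int_poly q :: 'a::field_char_0 poly)"
  by (simp add: map_poly_map_poly o_def)

text \<open>The minimal polynomial over the rationals already has integer coefficients: after clearing
  denominators, every rational polynomial that vanishes at \<open>x\<close> becomes a multiple of \<open>g\<close>.\<close>

lemma rat_min_poly_eq:
  fixes x :: "'a::field_char_0"
  assumes g: "min_int_poly g x"
  shows "rat_min_poly x = of_int_poly g"
  unfolding rat_min_poly_def
proof (rule the_equality)
  have min: "degree (of_int_poly g :: rat poly) \<le> degree q"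
    if q: "q \<noteq> 0" "poly (map_poly of_rat q) x = 0" for q
  proof -
    obtain d q' where d: "d > 0" "Polynomial.smult (of_int d) q = of_int_poly q'"
      using rat_poly_clear_denominators by blast
    have "poly (map_poly of_rat (Polynomial.smult (of_int d) q)) x = 0"
      using q by (simp add: hom_distribs)
    then have "g dvd q'" using g unfolding d(2) of_rat_poly_of_int_poly by (simp add: min_int_poly_def)
    moreover have "q' \<noteq> 0" using d q by auto
    ultimately have "degree g \<le> degree q'" by (rule dvd_imp_degree_le)
    also have "degree q' = degree (of_int_poly q' :: rat poly)" by simp
    also have "\<dots> = degree q" unfolding d(2)[symmetric] using d(1) by simp
    finally show ?thesis by simp
  qed
  have gx: "poly (map_poly of_rat (of_int_poly g)) x = 0"
    using g unfolding of_rat_poly_of_int_poly by (simp add: min_int_poly_def)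
  have monic: "lead_coeff (of_int_poly g :: rat poly) = 1" using g by (simp add: min_int_poly_def)
  show "lead_coeff (of_int_poly g :: rat poly) = 1 \<and> poly (map_poly of_rat (of_int_poly g)) x = 0 \<and>
    (\<forall>q. q \<noteq> 0 \<and> poly (map_poly of_rat q) x = 0 \<longrightarrow> degree (of_int_poly g :: rat poly) \<le> degree q)"
    using min gx monic by blast
  fix p assume p: "lead_coeff p = 1 \<and> poly (map_poly of_rat p) x = 0 \<and>
    (\<forall>q. q \<noteq> 0 \<and> poly (map_poly of_rat q) x = 0 \<longrightarrow> degree p \<le> degree q)"
  have "p \<noteq> 0" using p by auto
  have "(of_int_poly g :: rat poly) \<noteq> 0" using monic by force
  then have deg: "degree p = degree (of_int_poly g :: rat poly)"
    using p gx min[of p] \<open>p \<noteq> 0\<close> by (meson le_antisym)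
  show "p = of_int_poly g"
  proof (rule ccontr)
    assume "p \<noteq> of_int_poly g"
    then have "degree p \<le> degree (p - of_int_poly g)"
    proof -
      interpret of_rat_poly: map_poly_comm_ring_hom "of_rat :: rat \<Rightarrow> 'a" ..
      have "poly (map_poly of_rat (p - of_int_poly g)) x = 0"
        using p gx by (simp add: of_rat_poly.hom_minus)
      then show ?thesis using p \<open>p \<noteq> of_int_poly g\<close> by simp
    qed
    moreover have "p - of_int_poly g \<noteq> 0" using \<open>p \<noteq> of_int_poly g\<close> by simp
    moreover have "coeff (p - of_int_poly g) (degree p) = 0"
      using p monic deg by simp
    moreover have "degree (p - of_int_poly g) \<le> degree p" using deg by (intro degree_diff_le) auto
    ultimately show False using leading_coeff_neq_0 by (metis le_antisym)
  qed
qed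

lemma cyclotomic_poly_min_int_poly:
  assumes "n > 0"
  obtains g and w :: complex
  where "primitive_root_of_unity n w" "min_int_poly g w" "cyclotomic_poly n = of_int_poly g"
proof -
  define w where "w = (SOME z::complex. primitive_root_of_unity n z)"
  have w: "primitive_root_of_unity n w"
    unfolding w_def using complex_primitive_root_exists[OF assms] by (rule someI_ex)
  have "lead_coeff (monom 1 n - 1 :: int poly) = 1" using assms by (rule monic_unity_poly)
  moreover have "poly (of_int_poly (monom 1 n - 1)) w = 0"
    using w by (simp add: hom_distribs poly_monom primitive_root_of_unity_def)
  ultimately obtain g where "min_int_poly g w" using min_int_poly_exists by blast
  moreover have "cyclotomic_poly n = rat_min_poly w" by (simp add: cyclotomic_poly_def w_def)
  ultimately show ?thesis using that[OF w] rat_min_poly_eq by metis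
qed

section \<open>Factors of products of linear polynomials\<close>

text \<open>Both cofactors are described at once: in \<open>decomposable_equal_block_sums\<close>, the complementary
  multiset \<open>C\<close> is what makes the two blocks disjoint.\<close>

lemma split_product_of_linear_factors:
  fixes T S :: "'a::field poly"
  assumes "T * S = Polynomial.smult c (\<Prod>a\<in>#A. [:- a, 1:])" "c \<noteq> 0"
  shows "\<exists>B C d e. A = B + C \<and> T = Polynomial.smult d (\<Prod>a\<in>#B. [:- a, 1:])
    \<and> S = Polynomial.smult e (\<Prod>a\<in>#C. [:- a, 1:])"
  using assms(1)
proof (induction A arbitrary: T S)
  case empty
  then have TS: "T * S = [:c:]" by simp
  then have "T \<noteq> 0" "S \<noteq> 0" using \<open>c \<noteq> 0\<close> by auto
  then have "degree T + degree S = 0" using TS by (metis degree_mult_eq degree_pCons_0)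
  then obtain d e where "T = [:d:]" "S = [:e:]" by (metis add_is_0 degree_eq_zeroE)
  then show ?case by (intro exI[of _ "{#}"] exI[of _ d] exI[of _ e]) simp
next
  case (add x A)
  have root: "\<exists>B C d e. add_mset x A = B + C \<and> T = Polynomial.smult d (\<Prod>a\<in>#B. [:- a, 1:])
    \<and> S = Polynomial.smult e (\<Prod>a\<in>#C. [:- a, 1:])"
    if TS: "T * S = Polynomial.smult c (\<Prod>a\<in>#add_mset x A. [:- a, 1:])" and "poly T x = 0" for T S
  proof -
    obtain T' where T': "T = [:- x, 1:] * T'" using \<open>poly T x = 0\<close> by (auto simp: poly_eq_0_iff_dvd)
    have "[:- x, 1:] * (T' * S) = [:- x, 1:] * Polynomial.smult c (\<Prod>a\<in>#A. [:- a, 1:])"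
      using TS unfolding T' by (simp only: mult.assoc image_mset_add_mset prod_mset.add_mset mult_smult_right)
    then have "T' * S = Polynomial.smult c (\<Prod>a\<in>#A. [:- a, 1:])"
      by (simp only: mult_cancel_left) simp
    from add.IH[OF this] obtain B C d e where *: "A = B + C"
      "T' = Polynomial.smult d (\<Prod>a\<in>#B. [:- a, 1:])" "S = Polynomial.smult e (\<Prod>a\<in>#C. [:- a, 1:])"
      by blast
    have "T = Polynomial.smult d (\<Prod>a\<in>#add_mset x B. [:- a, 1:])"
      unfolding T' *(2) by (simp only: image_mset_add_mset prod_mset.add_mset mult_smult_right)
    moreover have "add_mset x A = add_mset x B + C" using * by simp
    ultimately show ?thesis using *(3) by blast
  qed
  have "poly (T * S) x = 0" unfolding add.prems by simp
  then consider "poly T x = 0" | "poly S x = 0" by auto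
  then show ?case
  proof cases
    case 1
    then show ?thesis using root[OF add.prems] by blast
  next
    case 2
    have "S * T = Polynomial.smult c (\<Prod>a\<in>#add_mset x A. [:- a, 1:])"
      using add.prems by (simp only: mult.commute[of S T])
    from root[OF this 2] show ?thesis by (metis union_commute)
  qed
qed

lemma linear_factors_degree:
  "degree (\<Prod>a\<in>#B. [:- a, 1:] :: 'a::field poly) = size B"
  "lead_coeff (\<Prod>a\<in>#B. [:- a, 1:] :: 'a::field poly) = 1"
proof (induction B)
  case (add x B)
  let ?P = "\<Prod>a\<in>#B. [:- a, 1:] :: 'a poly"
  have eq: "(\<Prod>a\<in>#add_mset x B. [:- a, 1:]) = [:- x, 1:] * ?P" by simp
  { case 1
    have "?P \<noteq> 0" using add.IH(2) by auto
    then show ?case unfolding eq by (subst degree_mult_eq) (use add.IH(1) in auto)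
  next
    case 2
    show ?case unfolding eq lead_coeff_mult using add.IH by simp
  }
qed simp_all

lemma linear_factors_second_coeff:
  "coeff (\<Prod>a\<in>#add_mset x B. [:- a, 1:] :: 'a::field poly) (size B) = - (x + \<Sum>\<^sub># B)"
proof (induction B arbitrary: x)
  case (add y B)
  let ?P = "\<Prod>a\<in>#add_mset y B. [:- a, 1:] :: 'a poly"
  have deg: "degree ?P = Suc (size B)" by (simp only: linear_factors_degree size_add_mset)
  have "coeff ?P (Suc (size B)) = 1" using linear_factors_degree(2)[of "add_mset y B"] deg by simp
  moreover have "(\<Prod>a\<in>#add_mset x (add_mset y B). [:- a, 1:]) = [:- x, 1:] * ?P" by simp
  ultimately show ?case using add[of y] by simp
qed simp

lemma root_of_factor:
  fixes T S :: "'a::field poly"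
  assumes "T * S = Polynomial.smult c (\<Prod>a\<in>#A. [:- a, 1:])" "c \<noteq> 0" "degree T > 0"
  shows "\<exists>a\<in>#A. poly T a = 0"
proof -
  obtain B C d where *: "A = B + C" "T = Polynomial.smult d (\<Prod>a\<in>#B. [:- a, 1:])"
    using split_product_of_linear_factors[OF assms(1,2)] by blast
  have "B \<noteq> {#}"
  proof
    assume "B = {#}"
    then have "T = [:d:]" using *(2) by simp
    then show False using assms(3) by simp
  qed
  then obtain b where "b \<in># B" by blast
  then have "poly T b = 0" unfolding *(2) by (auto simp: poly_prod_mset prod_mset_zero_iff)
  then show ?thesis using \<open>b \<in># B\<close> *(1) by auto
qed

lemma prod_linear_factors_dvd:
  fixes f :: "'a::field poly"
  assumes "finite A" "\<And>a. a \<in> A \<Longrightarrow> poly f a = 0"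
  shows "(\<Prod>a\<in>A. [:- a, 1:]) dvd f"
  using assms
proof (induction A arbitrary: f rule: finite_induct)
  case (insert a A)
  obtain f' where f: "f = [:- a, 1:] * f'"
    using insert.prems[of a] by (auto simp: poly_eq_0_iff_dvd)
  have "poly f' b = 0" if "b \<in> A" for b
    using insert.prems[of b] insert.hyps that by (auto simp: f)
  then have "(\<Prod>a\<in>A. [:- a, 1:]) dvd f'" by (rule insert.IH)
  then show ?case unfolding f prod.insert[OF insert.hyps] by (intro mult_dvd_mono dvd_refl)
qed simp

lemma mset_set_set_mset_eq:
  assumes "\<And>a. count M a \<le> 1"
  shows "mset_set (set_mset M) = M"
proof (rule multiset_eqI)
  fix a
  show "count (mset_set (set_mset M)) a = count M a"
  proof (cases "a \<in># M")
    case True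
    then have "count M a > 0" by simp
    then have "count M a = 1" using assms[of a] by linarith
    then show ?thesis using True by simp
  qed (simp add: not_in_iff)
qed

section \<open>Decompositions and sums of roots\<close>

text \<open>The sets \<open>B\<close> and \<open>C\<close> are the sets of roots of \<open>R - \<beta>\<close> and \<open>R - \<gamma>\<close> for two roots \<open>\<beta>\<close>
  and \<open>\<gamma>\<close> of \<open>Q\<close>. Such roots exist in the given field, because they are values of \<open>R\<close> at
  elements of \<open>A\<close>. The sum of the roots of \<open>R - \<beta>\<close> is determined by the two top coefficients of
  \<open>R - \<beta>\<close>, and since \<open>degree R \<ge> 2\<close> these do not depend on \<open>\<beta>\<close>.\<close>

lemma decomposable_equal_block_sums:
  fixes Q R :: "'a::field poly"
  assumes A: "finite A" and QR: "(\<Prod>a\<in>A. [:- a, 1:]) = pcompose Q R"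
    and deg: "degree Q \<ge> 2" "degree R \<ge> 2"
  shows "\<exists>B C. B \<subseteq> A \<and> C \<subseteq> A \<and> B \<noteq> {} \<and> B \<inter> C = {} \<and> \<Sum>B = \<Sum>C"
proof -
  let ?L = "\<lambda>M. \<Prod>a\<in>#M. [:- a, 1:] :: 'a poly"
  \<comment> \<open>If the composition \<open>Q \<circ> R\<close> divides a product of linear factors, then \<open>Q\<close> has a root
  of the form \<open>R a\<close>; it is split off.\<close>
  have lin: "\<exists>\<beta> Q1. Q = [:- \<beta>, 1:] * Q1 \<and> degree Q = Suc (degree Q1)"
    if Q: "pcompose Q R * S = Polynomial.smult c (?L M)" "c \<noteq> 0" "degree Q > 0" for Q S c M
  proof -
    have "degree (pcompose Q R) > 0" using Q deg by (simp add: degree_pcompose)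
    then obtain a where "poly (pcompose Q R) a = 0" using root_of_factor[OF Q(1,2)] by blast
    then have "poly Q (poly R a) = 0" by (simp add: poly_pcompose)
    then obtain Q1 where Q1: "Q = [:- poly R a, 1:] * Q1" by (auto simp: poly_eq_0_iff_dvd)
    then have "Q1 \<noteq> 0" using Q(3) by auto
    then have "degree Q = Suc (degree Q1)" unfolding Q1 by (subst degree_mult_eq) auto
    then show ?thesis using Q1 by blast
  qed
  have 0: "pcompose Q R * 1 = Polynomial.smult 1 (?L (mset_set A))"
    unfolding QR[symmetric] by (simp add: prod_unfold_prod_mset)
  have comp: "pcompose ([:- \<beta>, 1:] * S) R = (R - [:\<beta>:]) * pcompose S R" for \<beta> S
  proof -
    have "pcompose [:- \<beta>, 1:] R = R - [:\<beta>:]" by (simp add: pcompose_pCons)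
    then show ?thesis by (simp only: pcompose_mult)
  qed
  obtain \<beta> Q1 where Q1: "Q = [:- \<beta>, 1:] * Q1" "degree Q = Suc (degree Q1)"
    using lin[OF 0] deg by auto
  have 1: "(R - [:\<beta>:]) * pcompose Q1 R = Polynomial.smult 1 (?L (mset_set A))"
    using 0 unfolding Q1(1) comp by simp
  then obtain B M d e where B: "mset_set A = B + M" "R - [:\<beta>:] = Polynomial.smult d (?L B)"
    and M: "pcompose Q1 R = Polynomial.smult e (?L M)"
    using split_product_of_linear_factors[OF 1] by auto
  have "degree (pcompose Q1 R) > 0" using Q1(2) deg by (simp add: degree_pcompose)
  then have "e \<noteq> 0" using M by auto
  have 2: "pcompose Q1 R * 1 = Polynomial.smult e (?L M)" using M by simp
  obtain \<gamma> Q2 where Q2: "Q1 = [:- \<gamma>, 1:] * Q2"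
    using lin[OF 2 \<open>e \<noteq> 0\<close>] Q1(2) deg by auto
  have 3: "(R - [:\<gamma>:]) * pcompose Q2 R = Polynomial.smult e (?L M)"
    using 2 unfolding Q2(1) comp by simp
  then obtain C N d' where C: "M = C + N" "R - [:\<gamma>:] = Polynomial.smult d' (?L C)"
    using split_product_of_linear_factors[OF 3 \<open>e \<noteq> 0\<close>] by blast
  have sum: "size E = degree R \<and> - (lead_coeff R * \<Sum>\<^sub># E) = coeff R (degree R - 1)"
    if E: "R - [:\<delta>:] = Polynomial.smult k (?L E)" for \<delta> k E
  proof -
    have degR: "degree (R - [:\<delta>:]) = degree R"
      using deg degree_add_eq_left[of "- [:\<delta>:]" R] by (simp del: minus_pCons)
    then have "k \<noteq> 0" using deg E by auto
    then have size: "size E = degree R" using degR unfolding E by (simp add: linear_factors_degree)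
    have coeff: "coeff (R - [:\<delta>:]) i = coeff R i" if "i > 0" for i
      using that by (simp add: coeff_pCons split: nat.split)
    have "k = coeff (Polynomial.smult k (?L E)) (size E)"
      using linear_factors_degree[of E] by simp
    also have "\<dots> = lead_coeff R" using coeff[of "degree R"] deg size unfolding E[symmetric] by simp
    finally have k: "k = lead_coeff R" .
    obtain x F where F: "E = add_mset x F" using size deg by (cases E) auto
    have "size F = degree R - 1" "size F > 0" using size deg by (simp_all add: F)
    then have "coeff R (degree R - 1) = coeff (Polynomial.smult k (?L E)) (size F)"
      using coeff[of "size F"] unfolding E[symmetric] by simp
    also have "\<dots> = - (k * \<Sum>\<^sub># E)"
      unfolding F coeff_smult linear_factors_second_coeff by (simp add: algebra_simps)
    finally show ?thesis using size k by simp
  qed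
  have "lead_coeff R \<noteq> 0" using deg by auto
  then have sum_eq: "\<Sum>\<^sub># B = \<Sum>\<^sub># C" using sum[OF B(2)] sum[OF C(2)] by (metis mult_cancel_left neg_equal_iff_equal)
  have "B \<noteq> {#}" using sum[OF B(2)] deg by auto
  \<comment> \<open>The elements of \<open>A\<close> occur only once, so the multisets \<open>B\<close> and \<open>C\<close> are disjoint sets.\<close>
  have "mset_set A = B + C + N" using B(1) C(1) by simp
  then have "count B a + count C a + count N a = (if a \<in> A then 1 else 0)" for a
    using A by (metis count_mset_set(1,3) count_union)
  then have count: "count B a + count C a \<le> (if a \<in> A then 1 else 0)" for a
    by (metis le_add1)
  have le1: "count B a + count C a \<le> 1" for a by (rule order_trans[OF count]) simp
  have "count B a \<le> 1" "count C a \<le> 1" for a using le1[of a] by linarith+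
  then have "\<Sum>(set_mset B) = \<Sum>\<^sub># B" "\<Sum>(set_mset C) = \<Sum>\<^sub># C"
    by (simp_all add: sum_unfold_sum_mset mset_set_set_mset_eq)
  then have "\<Sum>(set_mset B) = \<Sum>(set_mset C)" using sum_eq by simp
  moreover have in_A: "a \<in> A" if "a \<in># B \<or> a \<in># C" for a
    using count[of a] that by (auto simp: count_eq_zero_iff split: if_splits)
  moreover have "a \<notin># C" if "a \<in># B" for a
  proof -
    have "count B a > 0" using that by simp
    then have "count C a = 0" using le1[of a] by linarith
    then show ?thesis by (simp add: count_eq_zero_iff)
  qed
  then have "set_mset B \<inter> set_mset C = {}" by blast
  moreover have "set_mset B \<subseteq> A" "set_mset C \<subseteq> A" using in_A by blast+
  ultimately show ?thesis using \<open>B \<noteq> {#}\<close> by (metis set_mset_eq_empty_iff)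
qed

text \<open>Let \<open>g\<close> be the minimal polynomial of a complex primitive root, and \<open>G\<close> its image over
  \<open>K\<close>. As \<open>G\<close> divides \<open>X ^ n - 1\<close>, which splits, it has a root in \<open>K\<close>. This root is primitive,
  because the minimal polynomial determines the order, and then all primitive roots of \<open>K\<close> are
  roots of \<open>G\<close>. There is nothing left over, because \<open>X ^ n - 1\<close> has no multiple roots.\<close>

lemma cyclotomic_poly_over_radically_closed:
  assumes K: "radically_closed TYPE('k::field_char_0)" and n: "n \<ge> 2"
  obtains g and z :: "'k::field_char_0"
  where "primitive_root_of_unity n z" "min_int_poly g z"
    "map_poly of_rat (cyclotomic_poly n)
      = (\<Prod>z | primitive_root_of_unity n z. [:- z, 1 :: 'k::field_char_0:])"
proof -
  obtain g and w :: complex where w: "primitive_root_of_unity n w" and g: "min_int_poly g w"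
    and cyc: "cyclotomic_poly n = of_int_poly g"
    using cyclotomic_poly_min_int_poly n by (metis gr0I not_numeral_le_zero)
  let ?G = "of_int_poly g :: 'k poly"
  have monic: "lead_coeff g = 1" using g by (simp add: min_int_poly_def)
  have "poly (of_int_poly (monom 1 n - 1)) w = 0"
    using w by (simp add: hom_distribs poly_monom primitive_root_of_unity_def)
  then obtain h where h: "monom 1 n - 1 = g * h" using min_int_poly_root_iff[OF g] by (auto elim: dvdE)
  have "of_int_poly (monom 1 n - 1) = ?G * of_int_poly h" unfolding h by (simp add: hom_distribs)
  then have GH: "monom 1 n - 1 = ?G * of_int_poly h" by (simp add: hom_distribs)
  obtain c A where cA: "monom 1 n - [:1::'k:] = Polynomial.smult c (\<Prod>a\<in>#A. [:- a, 1:])"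
    using K n unfolding radically_closed_def splits_def by blast
  have f_cA: "monom 1 n - 1 = Polynomial.smult c (\<Prod>a\<in>#A. [:- a, 1::'k:])"
    using cA by (simp add: one_pCons)
  have "lead_coeff (monom 1 n - 1 :: 'k poly) = 1" using n by (intro monic_unity_poly) simp
  then have "c \<noteq> 0" using f_cA by auto
  have root: "\<exists>a. poly T a = 0" if "T * S = monom 1 n - 1" "degree T > 0" for T S :: "'k poly"
    using root_of_factor[of T S c A] that f_cA \<open>c \<noteq> 0\<close> by auto
  have "degree ?G > 0"
  proof (rule ccontr)
    assume "\<not> degree ?G > 0"
    then have "g = 1" using monic by (auto elim!: degree_eq_zeroE)
    then show False using min_int_poly_root_iff[OF g, of g] by simp
  qed
  then obtain z where z: "poly ?G z = 0" using root GH by metis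
  have prim: "primitive_root_of_unity n z" if "poly ?G z = 0" for z
    using min_int_poly_root_primitive[OF g that] w by simp
  have gz: "min_int_poly g z" using min_int_poly_transfer[OF g z] .
  let ?P = "{z :: 'k. primitive_root_of_unity n z}"
  let ?D = "\<Prod>z\<in>?P. [:- z, 1 :: 'k:]"
  have fin: "finite ?P" using finite_card_primitive_roots[OF prim[OF z]] n by simp
  have "poly ?G z' = 0" if "z' \<in> ?P" for z'
    using min_int_poly_all_primitive_roots[OF gz prim[OF z]] that min_int_poly_root_iff[of g z' g] by simp
  then have "?D dvd ?G" by (rule prod_linear_factors_dvd[OF fin])
  then obtain E where E: "?G = ?D * E" by (elim dvdE)
  have "lead_coeff ?G = 1" using monic by simp
  moreover have "lead_coeff ?D = 1" by (simp add: lead_coeff_prod)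
  ultimately have "lead_coeff E = 1" unfolding E lead_coeff_mult by simp
  have "degree E = 0"
  proof (rule ccontr)
    assume "degree E \<noteq> 0"
    moreover have "E * (?D * of_int_poly h) = monom 1 n - 1" unfolding GH E by simp
    ultimately obtain y where y: "poly E y = 0" using root by blast
    then have "poly ?G y = 0" unfolding E by simp
    then have y_prim: "y \<in> ?P" using prim by simp
    obtain E' where E': "E = [:- y, 1:] * E'" using y by (auto simp: poly_eq_0_iff_dvd)
    obtain D' where D': "?D = [:- y, 1:] * D'" using fin y_prim by (metis prod.remove)
    have "monom 1 n - 1 = [:- y, 1:] * ([:- y, 1:] * (D' * E' * of_int_poly h))"
      unfolding GH E D' E' by (simp only: mult_ac)
    moreover have "poly [:- y, 1:] y = 0" by simp
    ultimately have "poly (pderiv (monom 1 n - 1)) y = 0"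
      by (simp only: pderiv_mult poly_add poly_mult mult_zero_left mult_zero_right add_0)
    then have "of_nat n * y ^ (n - 1) = 0" by (simp add: pderiv_diff pderiv_monom poly_monom)
    then have "y = 0" using n by simp
    then show False using y_prim n by (simp add: primitive_root_of_unity_def power_0_left)
  qed
  then have "E = 1" using \<open>lead_coeff E = 1\<close> by (auto elim!: degree_eq_zeroE)
  then have "map_poly of_rat (cyclotomic_poly n) = ?D"
    using E cyc by (simp add: of_rat_poly_of_int_poly)
  then show ?thesis using that prim[OF z] gz by blast
qed

section \<open>Linear independence for squarefree orders\<close>

text \<open>A relation is the vanishing at \<open>w\<close> of an integer polynomial \<open>q\<close> of degree less than \<open>n\<close>
  whose exponents are coprime to \<open>n\<close>. By conjugation \<open>q\<close> vanishes at \<open>w ^ b\<close> for all \<open>b\<close> coprime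
  to \<open>n\<close>. The other \<open>b\<close> are reached by induction on the number of primes dividing \<open>b\<close> and \<open>n\<close>:
  if \<open>p\<close> is one of them and \<open>n = p * k\<close>, then the values of \<open>q\<close> at \<open>w ^ (b + j * k)\<close> for \<open>j < p\<close>
  add up to 0, since every exponent \<open>a\<close> of \<open>q\<close> is prime to \<open>p\<close> and so
  \<open>w ^ (k * a)\<close> is a nontrivial \<open>p\<close>-th root of unity. As \<open>n\<close> is squarefree, \<open>p\<close> does not divide
  \<open>k\<close>, so for \<open>j > 0\<close> the exponent \<open>b + j * k\<close> has lost the prime \<open>p\<close> and gained no prime divisor
  of \<open>n\<close>. Hence \<open>q\<close> vanishes at all \<open>n\<close>-th roots of unity, which are too many.\<close>

lemma primitive_roots_linear_independent:
  fixes w z :: "'a::field_char_0" and c :: "'a \<Rightarrow> int"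
  assumes w: "primitive_root_of_unity n w" and g: "min_int_poly g w"
    and n: "squarefree n" "n > 1"
    and sum: "(\<Sum>z | primitive_root_of_unity n z. of_int (c z) * z) = 0"
    and z: "primitive_root_of_unity n z"
  shows "c z = 0"
proof -
  define q where "q = (\<Sum>a\<in>totatives n. monom (c (w ^ a)) a)"
  have q_eval: "poly (of_int_poly q) x = (\<Sum>a\<in>totatives n. of_int (c (w ^ a)) * x ^ a)" for x :: 'a
    by (simp add: q_def hom_distribs poly_sum poly_monom)
  note roots = primitive_roots_eq_image_totatives[OF w n(2)]
  have wn: "w ^ n = 1" using w by (simp add: primitive_root_of_unity_def)
  have "poly (of_int_poly q) w = 0"
    using sum unfolding roots(1) sum.reindex[OF roots(2)] q_eval by simp
  then have "g dvd q" using min_int_poly_root_iff[OF g] by blast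
  then have coprime_case: "poly (of_int_poly q) (w ^ b) = 0" if "coprime b n" for b
    using min_int_poly_coprime_power[OF g wn _ that] n(2) min_int_poly_root_iff[of g "w ^ b" q] by simp
  define primes where "primes b = {p. prime p \<and> p dvd n \<and> p dvd b}" for b
  have fin: "finite (primes b)" for b
    unfolding primes_def using n(2) by (intro finite_subset[OF _ finite_divisors_nat[of n]]) auto
  have all: "poly (of_int_poly q) (w ^ b) = 0" for b
  proof (induction "card (primes b)" arbitrary: b)
    case 0
    then have "primes b = {}" using fin by simp
    then have "coprime b n" unfolding primes_def using prime_factor_nat[of "gcd b n"]
      by (auto simp: coprime_iff_gcd_eq_1)
    then show ?case by (rule coprime_case)
  next
    case (Suc m)
    then obtain p where p: "p \<in> primes b" by (metis card.empty ex_in_conv nat.distinct(1))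
    then have pp: "prime p" "p dvd n" "p dvd b" by (simp_all add: primes_def)
    then obtain k where k: "n = p * k" by (elim dvdE)
    have "\<not> p dvd k"
    proof
      assume "p dvd k"
      then have "p ^ 2 dvd n" by (simp add: k power2_eq_square)
      then show False using n(1) pp(1) squarefreeD not_prime_unit by blast
    qed
    have "poly (of_int_poly q) (w ^ (b + j * k)) = 0" if j: "j \<in> {1..<p}" for j
    proof (rule Suc.hyps(1))
      have "\<not> p dvd j" using j by (auto dest: dvd_imp_le)
      then have "\<not> p dvd b + j * k"
        using pp \<open>\<not> p dvd k\<close> by (simp add: dvd_add_right_iff prime_dvd_mult_iff)
      moreover have "r dvd b + j * k \<longleftrightarrow> r dvd b" if "prime r" "r dvd n" "r \<noteq> p" for r
      proof -
        have "r dvd k" using that pp(1) unfolding k by (metis prime_dvd_mult_iff primes_dvd_imp_eq)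
        then show ?thesis by (simp add: dvd_add_left_iff)
      qed
      ultimately have "primes (b + j * k) = primes b - {p}"
        using pp unfolding primes_def by blast
      then show "m = card (primes (b + j * k))" using Suc.hyps(2) p by simp
    qed
    then have "(\<Sum>j\<in>{1..<p}. poly (of_int_poly q) (w ^ (b + j * k))) = 0" by simp
    moreover have "(\<Sum>j<p. poly (of_int_poly q) (w ^ (b + j * k))) = 0"
    proof -
      have "(\<Sum>j<p. (w ^ (b + j * k)) ^ a) = 0" if a: "a \<in> totatives n" for a
      proof -
        define \<zeta> where "\<zeta> = w ^ (k * a)"
        have "\<zeta> ^ p = (w ^ n) ^ a" by (simp add: \<zeta>_def k mult_ac flip: power_mult)
        then have "\<zeta> ^ p = 1" using wn by simp
        have "\<not> p dvd a" using a pp(1,2) by (auto simp: in_totatives_iff dest: coprime_common_divisor)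
        moreover have "k \<noteq> 0" using n(2) k by (cases k) auto
        ultimately have "\<not> n dvd k * a" by (simp add: k mult.commute)
        then have "\<zeta> \<noteq> 1" unfolding \<zeta>_def using primitive_root_power_eq_1_iff[OF w] by blast
        then have "(\<Sum>j<p. \<zeta> ^ j) = 0" using \<open>\<zeta> ^ p = 1\<close> by (simp add: sum_gp_strict)
        moreover have "(w ^ (b + j * k)) ^ a = (w ^ b) ^ a * \<zeta> ^ j" for j
          by (simp add: \<zeta>_def power_add power_mult_distrib mult_ac flip: power_mult)
        ultimately show ?thesis by (simp flip: sum_distrib_left)
      qed
      then have "(\<Sum>a\<in>totatives n. of_int (c (w ^ a)) * (\<Sum>j<p. (w ^ (b + j * k)) ^ a)) = 0"
        by simp
      then show ?thesis
        unfolding q_eval by (subst sum.swap) (simp add: sum_distrib_left)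
    qed
    moreover have "{..<p} = insert 0 {1..<p}" using prime_gt_0_nat[OF pp(1)] by auto
    ultimately show ?case by simp
  qed
  have "q = 0"
  proof (rule ccontr)
    assume "q \<noteq> 0"
    have "degree q \<le> n - 1"
    proof (unfold q_def, rule degree_sum_le)
      fix a assume "a \<in> totatives n"
      then have "a \<le> n - 1" using totatives_less[OF _ n(2)] by fastforce
      then show "degree (monom (c (w ^ a)) a) \<le> n - 1" by (rule order_trans[OF degree_monom_le])
    qed simp
    then have "degree (of_int_poly q :: 'a poly) < n" using n(2) by simp
    moreover have "(\<lambda>b. w ^ b) ` {..<n} \<subseteq> {x. poly (of_int_poly q) x = 0}" using all by auto
    then have "card ((\<lambda>b. w ^ b) ` {..<n}) \<le> card {x :: 'a. poly (of_int_poly q) x = 0}"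
      using \<open>q \<noteq> 0\<close> by (intro card_mono poly_roots_finite) auto
    then have "n \<le> card {x :: 'a. poly (of_int_poly q) x = 0}"
      using card_image[OF primitive_root_power_inj[OF w]] by simp
    moreover have "card {x :: 'a. poly (of_int_poly q) x = 0} \<le> degree (of_int_poly q :: 'a poly)"
      using \<open>q \<noteq> 0\<close> by (intro card_poly_roots_bound) simp
    ultimately show False by simp
  qed
  obtain a where a: "a \<in> totatives n" "z = w ^ a" using z roots(1) by blast
  have "coeff q a = (\<Sum>b\<in>totatives n. if b = a then c (w ^ b) else 0)"
    unfolding q_def coeff_sum by (intro sum.cong) auto
  also have "\<dots> = c z" using a by simp
  finally show ?thesis using \<open>q = 0\<close> by simp
qed

section \<open>Indecomposability\<close>

lemma not_decomposable_if_squarefree: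
  fixes h :: "'k::field_char_0 \<Rightarrow> 'l::field"
  assumes K: "radically_closed TYPE('k)" and h: "field_hom h"
    and n: "squarefree n" "n \<ge> 2"
  shows "\<not> decomposable_over h (map_poly of_rat (cyclotomic_poly n))"
proof
  interpret h: field_hom h by (rule h)
  interpret hp: map_poly_comm_ring_hom h ..
  assume "decomposable_over h (map_poly of_rat (cyclotomic_poly n))"
  then obtain Q R where QR: "degree Q \<ge> 2" "degree R \<ge> 2"
    and eq: "map_poly h (map_poly of_rat (cyclotomic_poly n)) = pcompose Q R"
    unfolding decomposable_over_def by blast
  obtain g and w :: 'k where w: "primitive_root_of_unity n w" and g: "min_int_poly g w"
    and cyc: "map_poly of_rat (cyclotomic_poly n) = (\<Prod>z | primitive_root_of_unity n z. [:- z, 1 :: 'k:])"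
    using cyclotomic_poly_over_radically_closed[OF K n(2)] by blast
  let ?P = "{z :: 'k. primitive_root_of_unity n z}"
  have fin: "finite ?P" using finite_card_primitive_roots[OF w] n by simp
  have inj: "inj h" by (rule h.inj_f)
  have "(\<Prod>a\<in>h ` ?P. [:- a, 1:]) = (\<Prod>z\<in>?P. [:- h z, 1:])"
    using inj by (subst prod.reindex) (auto intro: inj_on_subset)
  also have "\<dots> = pcompose Q R"
    unfolding eq[symmetric] cyc by (simp add: hp.hom_prod hom_distribs)
  finally obtain B C where BC: "B \<subseteq> h ` ?P" "C \<subseteq> h ` ?P" "B \<noteq> {}" "B \<inter> C = {}" "\<Sum>B = \<Sum>C"
    using decomposable_equal_block_sums[OF _ _ QR, of "h ` ?P"] fin by blast
  obtain B' where B': "B' \<subseteq> ?P" "B = h ` B'" using BC(1) subset_imageE by blast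
  obtain C' where C': "C' \<subseteq> ?P" "C = h ` C'" using BC(2) subset_imageE by blast
  have "h (\<Sum>B') = h (\<Sum>C')"
    using BC(5) inj unfolding B'(2) C'(2)
    by (simp add: sum.reindex inj_on_subset h.hom_sum)
  then have sum: "\<Sum>B' = \<Sum>C'" by (rule injD[OF inj])
  have disj: "B' \<inter> C' = {}" using BC(4) B' C' by blast
  \<comment> \<open>The difference of the two equal sums is a linear relation between primitive roots.\<close>
  define c :: "'k \<Rightarrow> int" where "c z = of_bool (z \<in> B') - of_bool (z \<in> C')" for z
  have "(\<Sum>z\<in>?P. of_int (c z) * z) = (\<Sum>z\<in>?P. (if z \<in> B' then z else 0) - (if z \<in> C' then z else 0))"
    by (intro sum.cong) (auto simp: c_def)
  also have "\<dots> = \<Sum>(?P \<inter> B') - \<Sum>(?P \<inter> C')"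
    using fin by (simp add: sum_subtractf sum.inter_restrict)
  also have "\<dots> = 0" using B'(1) C'(1) sum by (simp add: Int_absorb1)
  finally have c0: "c z = 0" if "z \<in> ?P" for z
    using primitive_roots_linear_independent[OF w g n(1)] n(2) that by simp
  obtain z where "z \<in> B'" using BC(3) B'(2) by blast
  then have "c z = 1" using disj by (auto simp: c_def)
  then show False using c0 \<open>z \<in> B'\<close> B'(1) by auto
qed

text \<open>The \<open>p\<close>-th power of a primitive root of order \<open>p * m\<close> has order \<open>m\<close>. So the cyclotomic
  polynomial of order \<open>p * m\<close> divides the one of order \<open>m\<close> composed with \<open>X ^ p\<close>, and both are
  monic of degree \<open>p * totient m\<close>: this is where \<open>p dvd m\<close> enters.\<close>

lemma decomposable_if_prime_dvd_cofactor:
  fixes h :: "'k::field_char_0 \<Rightarrow> 'l::field"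
  assumes K: "radically_closed TYPE('k)" and h: "field_hom h"
    and p: "prime p" and m: "p dvd m" "m > 2"
  shows "decomposable_over h (map_poly of_rat (cyclotomic_poly (p * m)))"
proof -
  interpret h: field_hom h by (rule h)
  have p2: "p \<ge> 2" using p by (rule prime_ge_2_nat)
  have pm: "p * m > 2" using p2 m(2) by (metis mult_le_mono1 mult_2 trans_less_add1 less_le_trans)
  let ?P = "\<lambda>n. {z :: 'k. primitive_root_of_unity n z}"
  let ?D = "\<lambda>n. \<Prod>z\<in>?P n. [:- z, 1 :: 'k:]"
  obtain w :: 'k where w: "primitive_root_of_unity (p * m) w"
    and cyc: "map_poly of_rat (cyclotomic_poly (p * m)) = ?D (p * m)"
    using cyclotomic_poly_over_radically_closed[OF K, of "p * m"] pm by (metis less_imp_le)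
  obtain v :: 'k where v: "primitive_root_of_unity m v"
    using cyclotomic_poly_over_radically_closed[OF K, of m] m(2) by (metis less_imp_le)
  have fin: "finite (?P (p * m))" "finite (?P m)"
    and card: "card (?P (p * m)) = totient (p * m)" "card (?P m) = totient m"
    using finite_card_primitive_roots[OF w] finite_card_primitive_roots[OF v] pm m(2) by auto
  have degD: "degree (?D n) = card (?P n)" for n
    by (subst degree_prod_eq_sum_degree) auto
  have monicD: "lead_coeff (?D n) = 1" for n by (simp add: lead_coeff_prod)
  have pow: "z ^ p \<in> ?P m" if "z \<in> ?P (p * m)" for z
  proof -
    have "(z ^ p) ^ k = 1 \<longleftrightarrow> m dvd k" for k
      using primitive_root_power_eq_1_iff[of "p * m" z "p * k"] that p2 by (simp flip: power_mult)
    then show ?thesis using m(2) by (auto simp: primitive_root_of_unity_def dest: dvd_imp_le)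
  qed
  let ?C = "pcompose (?D m) (monom 1 p)"
  have "poly ?C z = 0" if "z \<in> ?P (p * m)" for z
    using pow[OF that] fin by (simp add: poly_pcompose poly_monom poly_prod prod_zero_iff)
  then have "?D (p * m) dvd ?C" by (rule prod_linear_factors_dvd[OF fin(1)])
  then obtain E where E: "?C = ?D (p * m) * E" by (elim dvdE)
  have degC: "degree ?C = totient m * p"
    by (simp add: degree_pcompose degree_monom_eq degD card)
  have "lead_coeff ?C = 1"
    using p2 monicD[of m] by (subst lead_coeff_comp) (simp_all add: degree_monom_eq)
  then have monicE: "lead_coeff E = 1" unfolding E lead_coeff_mult monicD by simp
  have "totient (p * m) = p * totient m"
  proof -
    have "gcd p m = p" using m(1) by (simp add: gcd_nat.absorb1)
    then have "totient (p * m) * totient p = totient p * totient m * p"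
      using totient_gcd[of p m] by simp
    then show ?thesis using p2 by (simp add: mult_ac)
  qed
  moreover have "degree ?C = degree (?D (p * m)) + degree E"
    unfolding E by (intro degree_mult_eq) (metis monicD monicE leading_coeff_0_iff zero_neq_one)+
  ultimately have "degree E = 0" unfolding degC degD card by simp
  then have "E = 1" using monicE by (auto elim!: degree_eq_zeroE)
  then have "map_poly of_rat (cyclotomic_poly (p * m)) = ?C" using cyc E by simp
  then have comp: "map_poly h (map_poly of_rat (cyclotomic_poly (p * m)))
      = pcompose (map_poly h (?D m)) (map_poly h (monom 1 p))"
    by (simp add: h.map_poly_pcompose)
  have "totient m \<ge> 2" using totient_gt_1[OF m(2)] by simp
  then have "degree (map_poly h (?D m)) \<ge> 2" using degD card by simp
  moreover have "degree (map_poly h (monom 1 p)) \<ge> 2" using p2 by (simp add: degree_monom_eq)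
  moreover have "degree ?C \<ge> 2" unfolding degC using p2 \<open>totient m \<ge> 2\<close> by (metis mult_le_mono nat_le_iff_add le_trans mult_2 le_add1)
  ultimately show ?thesis
    using comp \<open>map_poly of_rat _ = ?C\<close> unfolding decomposable_over_def by metis
qed

lemma squarefree_iff_prod_primes:
  fixes n :: nat
  shows "squarefree n \<longleftrightarrow> (\<exists>S. finite S \<and> (\<forall>p\<in>S. prime p) \<and> n = \<Prod>S)"
proof
  assume "squarefree n"
  then have n0: "n \<noteq> 0" by (metis not_squarefree_0)
  have "n = (\<Prod>p\<in>prime_factors n. p ^ multiplicity p n)"
    using n0 by (simp add: prime_factorization_nat)
  also have "\<dots> = \<Prod>(prime_factors n)"
    using \<open>squarefree n\<close> n0 by (intro prod.cong) (auto simp: squarefree_factorial_semiring')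
  finally show "\<exists>S. finite S \<and> (\<forall>p\<in>S. prime p) \<and> n = \<Prod>S"
    by (intro exI[of _ "prime_factors n"]) auto
next
  assume "\<exists>S. finite S \<and> (\<forall>p\<in>S. prime p) \<and> n = \<Prod>S"
  then obtain S where S: "finite S" "\<forall>p\<in>S. prime p" "n = \<Prod>S" by blast
  have "squarefree (\<Prod>p\<in>S. p)"
    using S by (intro squarefree_prod_coprime) (auto simp: primes_coprime squarefree_prime)
  then show "squarefree n" using S by simp
qed

theorem proposition4p1:
  fixes n :: nat
    and h :: "'k::field_char_0 \<Rightarrow> 'l::field"
  assumes "radically_closed TYPE('k)"
    and "field_hom h"
    and "n \<ge> 3"
  shows "indecomposable_over h (map_poly of_rat (cyclotomic_poly n) :: 'k poly) \<longleftrightarrow>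
    (\<exists>S. finite S \<and> (\<forall>p\<in>S. prime p) \<and> n = \<Prod>S) \<or> n = 4"
proof -
  let ?\<Phi> = "map_poly of_rat (cyclotomic_poly n) :: 'k poly"
  have n: "n \<ge> 2" "n > 2" "n > 1" using assms(3) by simp_all
  obtain w :: 'k where w: "primitive_root_of_unity n w"
    and cyc: "?\<Phi> = (\<Prod>z | primitive_root_of_unity n z. [:- z, 1 :: 'k:])"
    using cyclotomic_poly_over_radically_closed[OF assms(1) n(1)] by metis
  have deg: "degree ?\<Phi> = totient n"
    unfolding cyc finite_card_primitive_roots(2)[OF w n(3), symmetric]
    by (subst degree_prod_eq_sum_degree) auto
  then have "degree ?\<Phi> \<ge> 2" using totient_gt_1[OF n(2)] by simp
  then have "indecomposable_over h ?\<Phi> \<longleftrightarrow> \<not> decomposable_over h ?\<Phi>"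
    by (simp add: indecomposable_over_def)
  also have "\<dots> \<longleftrightarrow> squarefree n \<or> n = 4"
  proof
    assume indec: "\<not> decomposable_over h ?\<Phi>"
    show "squarefree n \<or> n = 4"
    proof (rule ccontr)
      assume contra: "\<not> (squarefree n \<or> n = 4)"
      then obtain x where x: "x ^ 2 dvd n" "\<not> x dvd 1" by (auto simp: squarefree_def)
      then obtain p where p: "prime p" "p dvd x" using prime_factor_nat by (metis dvd_refl)
      then have "p ^ 2 dvd n" using x(1) dvd_power_same dvd_trans by blast
      then obtain k where "n = p ^ 2 * k" by (elim dvdE)
      then have k: "n = p * (p * k)" by (simp add: power2_eq_square)
      have "p * k > 2"
      proof (rule ccontr)
        assume "\<not> p * k > 2"
        moreover have "p \<ge> 2" using p(1) by (rule prime_ge_2_nat)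
        moreover have "k \<ge> 1" using k n by (cases k) auto
        ultimately have "p = 2" "k = 1"
          using mult_le_mono[of 2 p 1 k] mult_le_mono[of 2 p 2 k] mult_le_mono[of 3 p 1 k] by linarith+
        then show False using k contra by simp
      qed
      then show False
        using decomposable_if_prime_dvd_cofactor[OF assms(1,2) p(1), of "p * k"] indec k by simp
    qed
  next
    assume "squarefree n \<or> n = 4"
    then show "\<not> decomposable_over h ?\<Phi>"
    proof
      assume "squarefree n"
      then show ?thesis using not_decomposable_if_squarefree[OF assms(1,2) _ n(1)] by blast
    next
      assume "n = 4"
      interpret h: field_hom h by (rule assms(2))
      show ?thesis
      proof
        assume "decomposable_over h ?\<Phi>"
        then obtain Q R where QR: "degree Q \<ge> 2" "degree R \<ge> 2" "map_poly h ?\<Phi> = pcompose Q R"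
          unfolding decomposable_over_def by blast
        have "degree (map_poly h ?\<Phi>) = 2" using deg \<open>n = 4\<close> by simp
        then have "degree Q * degree R = 2" unfolding QR(3) by (simp add: degree_pcompose)
        then show False using mult_le_mono[OF QR(1,2)] by simp
      qed
    qed
  qed
  finally show ?thesis unfolding squarefree_iff_prod_primes .
qed

end
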